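(* Let $\ell:\mathbf{R}^p\to\mathbf{R}$ be convex and twice continuously differentiable, let $A,I\subset\mathbf{R}^p$ be bounded closed convex sets with $0\in\mathrm{relint}(I)$, let $E\subset\mathbf{R}^p$ be a subspace, put $M=E\cap\mathrm{span}(I)^\perp$, let $\theta^\star\in M$, $\lambda>0$, $r>0$, and let $C\subset\mathbf{R}^p$ be a convex set containing $\theta^\star$. Assume restricted strong convexity on $C\cap M$ and irrepresentability (both defined in the context). Assume further that the optimal solution $\hat\theta$ of $$\min_{\theta\in\mathbf{R}^p}\ \ell(\theta)+\lambda\bigl(h_A(\theta)+h_I(\theta)+h_{E^\perp}(\theta)\bigr)$$ is unique and satisfies $\hat\theta\in(\theta^\star+rB_2)\cap M$. Then there is $\hat z_A\in\partial h_A\bigl((\theta^\star+rB_2)\cap M\bigr)$ such that $$P_{M^\perp}QP_M(P_MQP_M)^\dagger(W+\lambda\hat z_A+R)\in P_{M^\perp}\bigl(W+R+\lambda(\hat z_A+I+E^\perp)\bigr),$$ where $W=\nabla\ell(\theta^\star)$ and $R=\nabla\ell(\hat\theta)-W-Q(\hat\theta-\theta^\star)$.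
   Context: $h_S(x)=\sup\{y^Tx: y\in S\}$ is the support function of $S$, so $h_{E^\perp}$ is $0$ on $E$ and $+\infty$ off $E$; $\gamma_I(x)=\inf\{t\ge0:x\in tI\}$ is the gauge of $I$ ($+\infty$ if there is no such $t$). $\partial h_A(\theta)=\{y\in A:y^T\theta=h_A(\theta)\}$ and, for a set $S$, $\partial h_A(S)=\bigcup_{\theta\in S}\partial h_A(\theta)$. $P_M,P_{M^\perp}$ are orthogonal projectors, $\dagger$ is the Moore–Penrose pseudoinverse, $Q=\nabla^2\ell(\theta^\star)$, $B_2$ is the Euclidean unit ball, and sums of points and sets are Minkowski sums. Restricted strong convexity on $C\cap M$: there are $m>0$, $L<\infty$ with (i) $\Delta^T\nabla^2\ell(\theta)\Delta\ge m\|\Delta\|_2^2$ for all $\theta\in C\cap M$, $\Delta\in(C\cap M)-(C\cap M)$; (ii) $\|\nabla^2\ell(\theta)-Q\|_2\le L\|\theta-\theta^\star\|_2$ for all $\theta\in C$. Let $V(z)=\inf_y\{\gamma_I(y)+\mathbf{1}_{E^\perp}(z-y)\}$, where $\mathbf{1}_{E^\perp}$ is $0$ on $E^\perp$ and $+\infty$ elsewhere. Irrepresentability: there is $\tau\in(0,1)$ with $\sup_{z\in\partial h_A(M)}V\bigl(P_{M^\perp}(QP_M(P_MQP_M)^\dagger P_Mz-z)\bigr)<1-\tau$. *)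

theory Defs
  imports "HOL-Analysis.Analysis"
begin

section \<open>Smooth functions\<close>

definition gradient :: "(real^'n \<Rightarrow> real) \<Rightarrow> real^'n \<Rightarrow> real^'n"
  where "gradient f x = (THE D. GDERIV f x :> D)"

definition hessian :: "(real^'n \<Rightarrow> real) \<Rightarrow> real^'n \<Rightarrow> real^'n^'n"
  where "hessian f x = jacobian (gradient f) (at x)"

definition twice_continuously_differentiable :: "(real^'n \<Rightarrow> real) \<Rightarrow> bool"
  where "twice_continuously_differentiable f \<longleftrightarrow>
    (\<forall>x. f differentiable (at x)) \<and>
    (\<forall>x. gradient f differentiable (at x)) \<and>
    continuous_on UNIV (hessian f)"

lemma gradient_eqI: "GDERIV f x :> D \<Longrightarrow> gradient f x = D"
  unfolding gradient_def
proof (rule the_equality)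
  fix D' assume "GDERIV f x :> D" "GDERIV f x :> D'"
  hence "(\<lambda>h. inner h D) = (\<lambda>h. inner h D')"
    unfolding gderiv_def by (rule has_derivative_unique)
  hence "inner h D = inner h D'" for h
    by (rule fun_cong)
  thus "D' = D"
    by (metis vector_eq_ldot)
qed

lemma GDERIV_gradient:
  assumes "f differentiable (at x)"
  shows "GDERIV f x :> gradient f x"
proof -
  obtain f' where f': "(f has_derivative f') (at x)"
    using assms by (auto simp: differentiable_def)
  have lin: "linear f'"
    using f' by (rule has_derivative_linear)
  have "f' = (\<lambda>h. inner h (adjoint f' 1))"
    using adjoint_works[OF lin, of _ 1] by (simp add: fun_eq_iff)
  hence "GDERIV f x :> adjoint f' 1"
    using f' unfolding gderiv_def by metis
  thus ?thesis
    using gradient_eqI by metis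
qed

lemma has_derivative_hessian:
  assumes "gradient f differentiable (at x)"
  shows "(gradient f has_derivative (\<lambda>h. hessian f x *v h)) (at x)"
  using assms by (simp add: hessian_def jacobian_works)


section \<open>Orthogonal projectors and the Moore--Penrose pseudoinverse\<close>

definition orth_projector :: "(real^'n) set \<Rightarrow> real^'n^'n"
  where "orth_projector S = (THE P. \<forall>x. P *v x \<in> S \<and> x - P *v x \<in> S\<^sup>\<bottom>)"

lemma orth_decomp_unique:
  assumes "subspace S" "a \<in> S" "b \<in> S" "x - a \<in> S\<^sup>\<bottom>" "x - b \<in> S\<^sup>\<bottom>"
  shows "a = b"
proof -
  have "a - b \<in> S"
    using assms subspace_diff by blast
  moreover have "a - b \<in> S\<^sup>\<bottom>"
    using subspace_diff[OF subspace_orthogonal_comp assms(5,4)] by simp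
  ultimately have "orthogonal (a - b) (a - b)"
    by (auto simp: orthogonal_comp_def)
  thus ?thesis
    by (simp add: orthogonal_self)
qed

lemma orth_projector_works:
  assumes S: "subspace S"
  shows "orth_projector S *v x \<in> S" and "x - orth_projector S *v x \<in> S\<^sup>\<bottom>"
proof -
  have "\<exists>a. a \<in> S \<and> x - a \<in> S\<^sup>\<bottom>" for x
  proof -
    have "x \<in> S + S\<^sup>\<bottom>"
      using subspace_sum_orthogonal_comp[OF S] by simp
    thus ?thesis
      by (auto elim!: set_plus_elim)
  qed
  then obtain g where g: "\<And>x. g x \<in> S" "\<And>x. x - g x \<in> S\<^sup>\<bottom>"
    by metis
  note perp = subspace_orthogonal_comp[of S]
  have "linear g"
  proof (rule linearI)
    fix x y c
    have "x + y - (g x + g y) = (x - g x) + (y - g y)"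
      by simp
    hence "x + y - (g x + g y) \<in> S\<^sup>\<bottom>"
      using g perp by (metis subspace_add)
    thus "g (x + y) = g x + g y"
      using g S by (intro orth_decomp_unique[OF S, of _ _ "x + y"]) (auto simp: subspace_add)
    have "c *\<^sub>R x - c *\<^sub>R g x \<in> S\<^sup>\<bottom>"
      using g perp by (metis subspace_scale scaleR_diff_right)
    thus "g (c *\<^sub>R x) = c *\<^sub>R g x"
      using g S by (intro orth_decomp_unique[OF S, of _ _ "c *\<^sub>R x"]) (auto simp: subspace_scale)
  qed
  hence mg: "matrix g *v x = g x" for x
    by (simp add: matrix_works)
  have "\<exists>!P. \<forall>x. P *v x \<in> S \<and> x - P *v x \<in> S\<^sup>\<bottom>"
  proof (rule ex1I[of _ "matrix g"])
    show "\<forall>x. matrix g *v x \<in> S \<and> x - matrix g *v x \<in> S\<^sup>\<bottom>"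
      using g by (simp add: mg)
    fix P assume P: "\<forall>x. P *v x \<in> S \<and> x - P *v x \<in> S\<^sup>\<bottom>"
    have "P *v x = matrix g *v x" for x
      using P g by (intro orth_decomp_unique[OF S, of _ _ x]) (auto simp: mg)
    thus "P = matrix g"
      by (simp add: matrix_eq)
  qed
  from theI'[OF this]
  show "orth_projector S *v x \<in> S" "x - orth_projector S *v x \<in> S\<^sup>\<bottom>"
    by (auto simp: orth_projector_def)
qed

lemma transpose_orth_projector:
  assumes S: "subspace S"
  shows "transpose (orth_projector S) = orth_projector S"
proof -
  let ?P = "orth_projector S"
  have key: "inner (?P *v x) y = inner (?P *v x) (?P *v y)" for x y
  proof -
    have "orthogonal (?P *v x) (y - ?P *v y)"
      using orth_projector_works[OF S] by (auto simp: orthogonal_comp_def)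
    thus ?thesis
      by (simp add: orthogonal_def inner_diff_right)
  qed
  have "inner (transpose ?P *v x) y = inner (?P *v x) y" for x y
    by (metis key inner_commute dot_lmul_matrix transpose_matrix_vector)
  hence "transpose ?P *v x = ?P *v x" for x
    by (metis vector_eq_rdot)
  thus ?thesis
    by (simp add: matrix_eq)
qed

definition is_pinv :: "real^'n^'m \<Rightarrow> real^'m^'n \<Rightarrow> bool"
  where "is_pinv A X \<longleftrightarrow> A ** X ** A = A \<and> X ** A ** X = X \<and>
    transpose (A ** X) = A ** X \<and> transpose (X ** A) = X ** A"

definition pinv :: "real^'n^'m \<Rightarrow> real^'m^'n"
  where "pinv A = (THE X. is_pinv A X)"

lemma is_pinv_unique:
  assumes X: "is_pinv A X" and Y: "is_pinv A Y"
  shows "X = Y"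
proof -
  have "A ** X = transpose ((A ** Y) ** (A ** X))"
    using X Y by (simp add: is_pinv_def matrix_mul_assoc)
  also have "\<dots> = (A ** X) ** (A ** Y)"
    using X Y by (simp add: is_pinv_def matrix_transpose_mul)
  also have "\<dots> = A ** Y"
    using X by (simp add: is_pinv_def matrix_mul_assoc)
  finally have AX: "A ** X = A ** Y" .
  have "X ** A = transpose ((X ** A) ** (Y ** A))"
    using X Y by (simp add: is_pinv_def) (metis matrix_mul_assoc)
  also have "\<dots> = (Y ** A) ** (X ** A)"
    using X Y by (simp add: is_pinv_def matrix_transpose_mul)
  also have "\<dots> = Y ** A"
    using X by (simp add: is_pinv_def) (metis matrix_mul_assoc)
  finally have XA: "X ** A = Y ** A" .
  have "X = X ** (A ** X)"
    using X by (simp add: is_pinv_def matrix_mul_assoc)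
  also have "\<dots> = Y ** A ** Y"
    by (simp add: AX matrix_mul_assoc XA)
  also have "\<dots> = Y"
    using Y by (simp add: is_pinv_def)
  finally show ?thesis .
qed

lemma is_pinv_pinv: "is_pinv A (pinv A)"
proof -
  define K where "K = {x. A *v x = 0}"
  have K: "subspace K"
    unfolding K_def by (simp add: subspace_def matrix_vector_right_distrib matrix_vector_mult_scaleR)
  define P where "P = orth_projector (K\<^sup>\<bottom>)"
  define R where "R = orth_projector (range ((*v) A))"
  have sK: "subspace (K\<^sup>\<bottom>)"
    by (rule subspace_orthogonal_comp)
  have sR: "subspace (range ((*v) A))"
    by (rule linear_subspace_image) simp_all
  have Pm: "P *v x \<in> K\<^sup>\<bottom>" for x
    using orth_projector_works[OF sK] by (simp add: P_def)
  have AP: "A *v (P *v x) = A *v x" for x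
  proof -
    have "x - P *v x \<in> K"
      using orth_projector_works(2)[OF sK] by (simp add: P_def orthogonal_comp_self K)
    thus ?thesis
      by (simp add: K_def matrix_vector_mult_diff_distrib)
  qed
  have inj: "inj_on ((*v) A) (K\<^sup>\<bottom>)"
  proof (rule inj_onI)
    fix x y assume xy: "x \<in> K\<^sup>\<bottom>" "y \<in> K\<^sup>\<bottom>" "A *v x = A *v y"
    have "x - y \<in> K\<^sup>\<bottom>"
      using xy sK by (simp add: subspace_diff)
    moreover have "x - y \<in> K"
      using xy by (simp add: K_def matrix_vector_mult_diff_distrib)
    ultimately have "orthogonal (x - y) (x - y)"
      by (auto simp: orthogonal_comp_def)
    thus "x = y"
      by (simp add: orthogonal_self)
  qed
  obtain g where g: "linear g" "\<And>v. v \<in> K\<^sup>\<bottom> \<Longrightarrow> g (A *v v) = v"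
    using linear_exists_left_inverse_on[OF _ sK inj] by auto
  have gA: "g (A *v x) = P *v x" for x
    using g(2)[OF Pm] AP by metis
  have RA: "R *v (A *v x) = A *v x" for x
  proof (rule orth_decomp_unique[OF sR, of _ _ "A *v x"])
    show "A *v x - A *v x \<in> (range ((*v) A))\<^sup>\<bottom>"
      by (simp add: subspace_0 subspace_orthogonal_comp)
  qed (use orth_projector_works[OF sR] in \<open>auto simp: R_def\<close>)
  define X where "X = matrix g ** R"
  have Xv: "X *v y = g (R *v y)" for y
    using g(1) by (simp add: X_def matrix_works flip: matrix_vector_mul_assoc)
  have XA: "X ** A = P"
    by (simp add: matrix_eq Xv RA gA flip: matrix_vector_mul_assoc)
  have AX: "A ** X = R"
  proof -
    have "A *v (X *v y) = R *v y" for y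
    proof -
      obtain u where "R *v y = A *v u"
        using orth_projector_works(1)[OF sR, of y] by (auto simp: R_def)
      thus ?thesis
        by (simp add: Xv gA AP)
    qed
    thus ?thesis
      by (simp add: matrix_eq flip: matrix_vector_mul_assoc)
  qed
  have RR: "R *v (R *v y) = R *v y" for y
    using orth_projector_works(1)[OF sR, of y] RA by (auto simp: R_def)
  have "A ** X ** A = A"
    by (simp add: AX matrix_eq RA flip: matrix_vector_mul_assoc)
  moreover have "X ** A ** X = X"
  proof -
    have "X ** R = X"
      by (simp add: matrix_eq Xv RR flip: matrix_vector_mul_assoc)
    thus ?thesis
      by (metis AX matrix_mul_assoc)
  qed
  moreover have "transpose (A ** X) = A ** X" "transpose (X ** A) = X ** A"
    using transpose_orth_projector[OF sR] transpose_orth_projector[OF sK]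
    by (simp_all add: AX XA P_def R_def)
  ultimately have "is_pinv A X"
    by (simp add: is_pinv_def)
  thus ?thesis
    unfolding pinv_def using is_pinv_unique by (metis theI)
qed


section \<open>Support functions and gauges\<close>

definition support_fun :: "(real^'n) set \<Rightarrow> real^'n \<Rightarrow> ereal"
  where "support_fun S x = (SUP y\<in>S. ereal (y \<bullet> x))"

definition support_face :: "(real^'n) set \<Rightarrow> real^'n \<Rightarrow> (real^'n) set"
  where "support_face S \<theta> = {y \<in> S. ereal (y \<bullet> \<theta>) = support_fun S \<theta>}"

text \<open>\<open>Inf {} = \<infinity>\<close> in \<^typ>\<open>ereal\<close>, so the gauge is \<open>\<infinity>\<close> where no dilate contains the point.\<close>

definition gauge_fun :: "(real^'n) set \<Rightarrow> real^'n \<Rightarrow> ereal"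
  where "gauge_fun S x = (INF t\<in>{t. 0 \<le> t \<and> x \<in> (*\<^sub>R) t ` S}. ereal t)"

definition convex_indicator :: "(real^'n) set \<Rightarrow> real^'n \<Rightarrow> ereal"
  where "convex_indicator S x = (if x \<in> S then 0 else \<infinity>)"


section \<open>Penalized M-estimation\<close>

definition model_subspace :: "(real^'n) set \<Rightarrow> (real^'n) set \<Rightarrow> (real^'n) set"
  where "model_subspace I E = E \<inter> (span I)\<^sup>\<bottom>"

definition penalized_objective ::
    "(real^'n \<Rightarrow> real) \<Rightarrow> real \<Rightarrow> (real^'n) set \<Rightarrow> (real^'n) set \<Rightarrow> (real^'n) set \<Rightarrow> real^'n \<Rightarrow> ereal"
  where "penalized_objective f lam A I E \<theta> =
    ereal (f \<theta>) + ereal lam * (support_fun A \<theta> + support_fun I \<theta> + support_fun (E\<^sup>\<bottom>) \<theta>)"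

text \<open>The operator norm is the spectral norm, as \<^typ>\<open>real^'n\<close> carries the Euclidean norm.\<close>

definition restricted_strongly_convex ::
    "(real^'n \<Rightarrow> real) \<Rightarrow> real^'n \<Rightarrow> (real^'n) set \<Rightarrow> (real^'n) set \<Rightarrow> bool"
  where "restricted_strongly_convex f \<theta>s C M \<longleftrightarrow>
    (\<exists>m L. m > 0 \<and>
      (\<forall>\<theta>\<in>C \<inter> M. \<forall>x\<in>C \<inter> M. \<forall>y\<in>C \<inter> M.
        (x - y) \<bullet> (hessian f \<theta> *v (x - y)) \<ge> m * (norm (x - y))\<^sup>2) \<and>
      (\<forall>\<theta>\<in>C. onorm ((*v) (hessian f \<theta> - hessian f \<theta>s)) \<le> L * norm (\<theta> - \<theta>s)))"

definition gauge_modulo :: "(real^'n) set \<Rightarrow> (real^'n) set \<Rightarrow> real^'n \<Rightarrow> ereal"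
  where "gauge_modulo I E z = (INF y. gauge_fun I y + convex_indicator (E\<^sup>\<bottom>) (z - y))"

definition irrepresentable ::
    "real^'n^'n \<Rightarrow> (real^'n) set \<Rightarrow> (real^'n) set \<Rightarrow> (real^'n) set \<Rightarrow> bool"
  where "irrepresentable Q A I E \<longleftrightarrow>
    (let M = model_subspace I E; P = orth_projector M; P' = orth_projector (M\<^sup>\<bottom>) in
      \<exists>\<tau>::real. 0 < \<tau> \<and> \<tau> < 1 \<and>
        (SUP z\<in>(\<Union>\<theta>\<in>M. support_face A \<theta>).
          gauge_modulo I E (P' *v ((Q ** P ** pinv (P ** Q ** P) ** P) *v z - z)))
        < ereal (1 - \<tau>))"

end

theory Submission
  imports Defs
begin

text \<open>Stationarity at \<open>\<theta>hat\<close> reads \<open>Q \<Delta> + W + R + lam (zA + zI + zE) = 0\<close> with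
  \<open>\<Delta> = \<theta>hat - \<theta>star \<in> M\<close> and \<open>zI + zE \<in> M\<^sup>\<bottom>\<close>. Projecting onto \<open>M\<close> turns \<open>W + lam zA + R\<close> into
  \<open>- PM Q \<Delta>\<close>. Since \<open>Q\<close> is symmetric and positive semidefinite, the kernel of \<open>PM Q PM\<close> is that of
  \<open>Q PM\<close>, so \<open>Q PM (PM Q PM)\<^sup>\<dagger> PM Q \<Delta> = Q \<Delta>\<close> although \<open>PM Q PM\<close> need not be injective on \<open>M\<close>.\<close>

section \<open>Derivatives along lines and convexity\<close>

lemma GDERIV_along_line:
  fixes f :: "'a::real_inner \<Rightarrow> real"
  assumes "GDERIV f (x + t *\<^sub>R d) :> g"
  shows "((\<lambda>s. f (x + s *\<^sub>R d)) has_real_derivative d \<bullet> g) (at t)"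
proof -
  have "((\<lambda>s. x + s *\<^sub>R d) has_derivative (\<lambda>s. s *\<^sub>R d)) (at t)"
    by (auto intro!: derivative_eq_intros)
  from has_derivative_compose[OF this] assms
  have "((\<lambda>s. f (x + s *\<^sub>R d)) has_derivative (\<lambda>s. (s *\<^sub>R d) \<bullet> g)) (at t)"
    unfolding gderiv_def by blast
  thus ?thesis
    by (simp add: has_field_derivative_def mult.commute[of _ "d \<bullet> g"])
qed

text \<open>Passing to the limit in right difference quotients keeps the bound. Inequalities that
  convexity or minimality gives on a segment become derivative inequalities this way.\<close>

lemma DERIV_ge_right:
  fixes f :: "real \<Rightarrow> real"
  assumes "(f has_real_derivative D) (at 0)"
    and "\<And>t. 0 < t \<Longrightarrow> t < 1 \<Longrightarrow> f t - f 0 \<ge> t * c"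
  shows "D \<ge> c"
proof -
  have "((\<lambda>t. (f t - f 0) / t) \<longlongrightarrow> D) (at_right 0)"
    using assms(1) unfolding has_field_derivative_iff
    by (auto intro: filterlim_mono at_le)
  moreover have "\<forall>\<^sub>F t in at_right 0. (f t - f 0) / t \<ge> c"
    unfolding eventually_at_right_field
    using assms(2) by (intro exI[of _ 1]) (auto simp: field_simps)
  ultimately show ?thesis
    by (intro tendsto_lowerbound) auto
qed

lemma convex_on_ge_tangent:
  fixes f :: "'a::real_inner \<Rightarrow> real"
  assumes "convex_on UNIV f" and "GDERIV f x :> g"
  shows "f y \<ge> f x + (y - x) \<bullet> g"
proof -
  have "((\<lambda>s. f (x + s *\<^sub>R (y - x))) has_real_derivative (y - x) \<bullet> g) (at 0)"
    using assms(2) by (intro GDERIV_along_line) simp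
  \<comment> \<open>\<open>DERIV_ge_right\<close> yields lower bounds only, while convexity bounds
    the difference quotients of \<open>f\<close> from above, hence the passage to
    \<open>- f\<close>.\<close>
  from DERIV_minus[OF this] have "- ((y - x) \<bullet> g) \<ge> - (f y - f x)"
  proof (rule DERIV_ge_right)
    fix t :: real assume t: "0 < t" "t < 1"
    have "x + t *\<^sub>R (y - x) = (1 - t) *\<^sub>R x + t *\<^sub>R y"
      by (simp add: algebra_simps)
    moreover have "f ((1 - t) *\<^sub>R x + t *\<^sub>R y) \<le> (1 - t) * f x + t * f y"
      using t assms(1) by (intro convex_onD) auto
    ultimately show "- f (x + t *\<^sub>R (y - x)) - - f (x + 0 *\<^sub>R (y - x)) \<ge> t * (- (f y - f x))"
      by (simp add: algebra_simps)
  qed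
  thus ?thesis by simp
qed

text \<open>Adding the tangent inequalities at \<open>x\<close> and at
  \<open>x + t *\<^sub>R v\<close> shows that the gradient is monotone along \<open>v\<close>; its
  derivative along \<open>v\<close> then has nonnegative inner product with
  \<open>v\<close>.\<close>

lemma convex_second_derivative_nonneg:
  fixes f :: "real^'n \<Rightarrow> real" and Q :: "real^'n^'n"
  assumes conv: "convex_on UNIV f" and G: "\<And>y. GDERIV f y :> G y"
    and Q: "(G has_derivative (\<lambda>h. Q *v h)) (at x)"
  shows "v \<bullet> (Q *v v) \<ge> 0"
proof -
  have "((\<lambda>s. x + s *\<^sub>R v) has_derivative (\<lambda>s. s *\<^sub>R v)) (at 0)"
    by (auto intro!: derivative_eq_intros)
  from has_derivative_compose[OF this, of G "\<lambda>h. Q *v h"] Q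
  have "((\<lambda>s. G (x + s *\<^sub>R v)) has_derivative (\<lambda>s. Q *v (s *\<^sub>R v))) (at 0)"
    by simp
  hence "((\<lambda>s. v \<bullet> G (x + s *\<^sub>R v)) has_derivative (\<lambda>s. v \<bullet> (Q *v (s *\<^sub>R v)))) (at 0)"
    by (rule has_derivative_inner_right)
  hence "((\<lambda>s. v \<bullet> G (x + s *\<^sub>R v)) has_real_derivative v \<bullet> (Q *v v)) (at 0)"
    by (simp add: has_field_derivative_def matrix_vector_mult_scaleR mult.commute[of _ "v \<bullet> (Q *v v)"])
  thus ?thesis
  proof (rule DERIV_ge_right)
    fix t :: real assume t: "0 < t" "t < 1"
    let ?y = "x + t *\<^sub>R v"
    have "f ?y \<ge> f x + (?y - x) \<bullet> G x" "f x \<ge> f ?y + (x - ?y) \<bullet> G ?y"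
      using convex_on_ge_tangent[OF conv G] by blast+
    hence "t * (v \<bullet> G ?y - v \<bullet> G x) \<ge> 0"
      by (simp add: algebra_simps)
    thus "v \<bullet> G (x + t *\<^sub>R v) - v \<bullet> G (x + 0 *\<^sub>R v) \<ge> t * 0"
      using t by (simp add: zero_le_mult_iff)
  qed
qed

section \<open>Symmetry of the second derivative\<close>

text \<open>The mean value theorem in direction \<open>v\<close>, applied to the first difference in
  direction \<open>u\<close>, leaves a difference of two gradients near \<open>x\<close>; expanding
  both at \<open>x\<close> gives the bilinear term.\<close>

lemma second_difference_estimate:
  fixes f :: "real^'n \<Rightarrow> real" and Q :: "real^'n^'n"
  assumes G: "\<And>y. GDERIV f y :> G y"
    and Q: "(G has_derivative (\<lambda>h. Q *v h)) (at x)" and "e > 0"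
  shows "\<exists>\<delta>>0. \<forall>t. 0 < t \<and> t < \<delta> \<longrightarrow>
    \<bar>f (x + t *\<^sub>R u + t *\<^sub>R v) - f (x + t *\<^sub>R u) - f (x + t *\<^sub>R v) + f x - t\<^sup>2 * (v \<bullet> (Q *v u))\<bar> \<le> e * t\<^sup>2"
proof -
  \<comment> \<open>For \<open>0 < z < 1\<close> the displacements of \<open>?a\<close> and
    \<open>?b\<close> from \<open>x\<close> have norms summing to at most \<open>t * N\<close>. The
    \<open>1\<close> keeps \<open>N\<close> positive, and \<open>N\<close> also bounds
    \<open>norm v\<close>, so dividing \<open>e\<close> by \<open>N * N\<close> makes the final
    error \<open>e * t\<^sup>2\<close>.\<close>
  define N where "N = norm u + 2 * norm v + 1"
  have N: "N > 0" "norm v \<le> N"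
    by (auto simp: N_def intro: add_nonneg_pos)
  define e' where "e' = e / (N * N)"
  have e': "e' > 0"
    using N \<open>e > 0\<close> by (simp add: e'_def)
  obtain d where d: "d > 0"
    "\<And>y. norm (y - x) < d \<Longrightarrow> norm (G y - G x - Q *v (y - x)) \<le> e' * norm (y - x)"
    using Q e' unfolding has_derivative_at_alt by blast
  show ?thesis
  proof (intro exI[of _ "d / N"] conjI allI impI)
    show "d / N > 0" using d N by simp
    fix t :: real assume t: "0 < t \<and> t < d / N"
    hence tN: "t * N < d" using N by (simp add: field_simps)
    let ?\<phi> = "\<lambda>s. f ((x + t *\<^sub>R u) + s *\<^sub>R (t *\<^sub>R v)) - f (x + s *\<^sub>R (t *\<^sub>R v))"
    let ?\<phi>' = "\<lambda>s. (t *\<^sub>R v) \<bullet> G ((x + t *\<^sub>R u) + s *\<^sub>R (t *\<^sub>R v)) - (t *\<^sub>R v) \<bullet> G (x + s *\<^sub>R (t *\<^sub>R v))"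
    have "DERIV ?\<phi> s :> ?\<phi>' s" for s
      by (intro DERIV_diff GDERIV_along_line G)
    then obtain z where z: "0 < z" "z < 1" "?\<phi> 1 - ?\<phi> 0 = (1 - 0) * ?\<phi>' z"
      using MVT2[of 0 1 ?\<phi> ?\<phi>'] by auto
    let ?a = "x + t *\<^sub>R u + z *\<^sub>R (t *\<^sub>R v)" and ?b = "x + z *\<^sub>R (t *\<^sub>R v)"
    let ?ra = "G ?a - G x - Q *v (?a - x)" and ?rb = "G ?b - G x - Q *v (?b - x)"
    have zv: "norm (z *\<^sub>R (t *\<^sub>R v)) \<le> t * norm v"
      using z t by (simp add: mult_left_le_one_le)
    have na: "norm (?a - x) \<le> t * (norm u + norm v)"
      using norm_triangle_ineq[of "t *\<^sub>R u" "z *\<^sub>R (t *\<^sub>R v)"] zv t by (simp add: algebra_simps)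
    have nb: "norm (?b - x) \<le> t * norm v"
      using zv by simp
    have "t * (norm u + norm v) \<le> t * N" "t * norm v \<le> t * N"
      using t by (auto simp: N_def intro!: mult_left_mono add_nonneg_nonneg)
    hence "norm ?ra \<le> e' * norm (?a - x)" "norm ?rb \<le> e' * norm (?b - x)"
      using na nb tN by (intro d(2); linarith)+
    hence "norm (?ra - ?rb) \<le> e' * norm (?a - x) + e' * norm (?b - x)"
      using norm_triangle_ineq4[of ?ra ?rb] by linarith
    also have "\<dots> \<le> e' * (t * (norm u + norm v)) + e' * (t * norm v)"
      using na nb e' by (intro add_mono mult_left_mono) auto
    also have "\<dots> \<le> e' * (t * N)"
      using e' t by (simp add: N_def algebra_simps)
    finally have r: "norm (?ra - ?rb) \<le> e' * (t * N)" .
    \<comment> \<open>\<open>G x\<close> cancels, and \<open>?a - ?b\<close> is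
      \<open>t *\<^sub>R u\<close> whatever the intermediate point \<open>z\<close> is.\<close>
    have diff: "?ra - ?rb = G ?a - G ?b - t *\<^sub>R (Q *v u)"
      by (simp add: algebra_simps)
    have eq: "f (x + t *\<^sub>R u + t *\<^sub>R v) - f (x + t *\<^sub>R u) - f (x + t *\<^sub>R v) + f x - t\<^sup>2 * (v \<bullet> (Q *v u))
        = t * (v \<bullet> (?ra - ?rb))"
      unfolding diff using z(3) by (simp add: power2_eq_square algebra_simps)
    have "\<bar>t * (v \<bullet> (?ra - ?rb))\<bar> \<le> t * (norm v * norm (?ra - ?rb))"
      using t Cauchy_Schwarz_ineq2[of v "?ra - ?rb"] by (simp add: abs_mult)
    also have "\<dots> \<le> t * (N * (e' * (t * N)))"
      using t mult_mono[OF N(2) r] N(1) by (intro mult_left_mono) simp_all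
    also have "\<dots> = e * t\<^sup>2"
      using N by (simp add: e'_def power2_eq_square)
    finally show "\<bar>f (x + t *\<^sub>R u + t *\<^sub>R v) - f (x + t *\<^sub>R u) - f (x + t *\<^sub>R v) + f x
        - t\<^sup>2 * (v \<bullet> (Q *v u))\<bar> \<le> e * t\<^sup>2"
      unfolding eq .
  qed
qed

text \<open>The second difference is unchanged when \<open>u\<close> and \<open>v\<close> are
  swapped, and divided by \<open>t\<^sup>2\<close> it approximates both bilinear values.\<close>

lemma second_derivative_symmetric:
  fixes f :: "real^'n \<Rightarrow> real" and Q :: "real^'n^'n"
  assumes G: "\<And>y. GDERIV f y :> G y"
    and Q: "(G has_derivative (\<lambda>h. Q *v h)) (at x)"
  shows "v \<bullet> (Q *v u) = u \<bullet> (Q *v v)"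
proof -
  have "\<bar>v \<bullet> (Q *v u) - u \<bullet> (Q *v v)\<bar> \<le> 0 + 2 * e" if e: "e > 0" for e
  proof -
    obtain \<delta>1 \<delta>2 where \<delta>: "\<delta>1 > 0" "\<delta>2 > 0"
      and 1: "\<And>t. 0 < t \<and> t < \<delta>1 \<Longrightarrow> \<bar>f (x + t *\<^sub>R u + t *\<^sub>R v) - f (x + t *\<^sub>R u) - f (x + t *\<^sub>R v)
          + f x - t\<^sup>2 * (v \<bullet> (Q *v u))\<bar> \<le> e * t\<^sup>2"
      and 2: "\<And>t. 0 < t \<and> t < \<delta>2 \<Longrightarrow> \<bar>f (x + t *\<^sub>R v + t *\<^sub>R u) - f (x + t *\<^sub>R v) - f (x + t *\<^sub>R u)
          + f x - t\<^sup>2 * (u \<bullet> (Q *v v))\<bar> \<le> e * t\<^sup>2"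
      using second_difference_estimate[OF G Q e] by metis
    define t where "t = min \<delta>1 \<delta>2 / 2"
    have t: "0 < t" "t < \<delta>1" "t < \<delta>2"
      using \<delta> by (auto simp: t_def)
    have "f (x + t *\<^sub>R v + t *\<^sub>R u) = f (x + t *\<^sub>R u + t *\<^sub>R v)"
      by (simp add: add.commute add.left_commute)
    hence "\<bar>t\<^sup>2 * (v \<bullet> (Q *v u)) - t\<^sup>2 * (u \<bullet> (Q *v v))\<bar> \<le> e * t\<^sup>2 + e * t\<^sup>2"
      using 1[of t] 2[of t] t unfolding abs_le_iff by linarith
    moreover have "\<bar>t\<^sup>2 * (v \<bullet> (Q *v u)) - t\<^sup>2 * (u \<bullet> (Q *v v))\<bar> = t\<^sup>2 * \<bar>v \<bullet> (Q *v u) - u \<bullet> (Q *v v)\<bar>"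
      by (simp add: abs_mult flip: right_diff_distrib)
    moreover have "e * t\<^sup>2 + e * t\<^sup>2 = t\<^sup>2 * (2 * e)"
      by simp
    ultimately have "t\<^sup>2 * \<bar>v \<bullet> (Q *v u) - u \<bullet> (Q *v v)\<bar> \<le> t\<^sup>2 * (2 * e)"
      by linarith
    thus ?thesis
      using t by simp
  qed
  hence "\<bar>v \<bullet> (Q *v u) - u \<bullet> (Q *v v)\<bar> \<le> 0 + e" if "e > 0" for e
    using that by (metis field_sum_of_halves half_gt_zero mult_2)
  hence "\<bar>v \<bullet> (Q *v u) - u \<bullet> (Q *v v)\<bar> \<le> 0"
    using field_le_epsilon by blast
  thus ?thesis by simp
qed

section \<open>Kernel of a positive semidefinite form\<close>

text \<open>Evaluated at \<open>v - s *\<^sub>R (Q *v v)\<close>, the form is a quadratic in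
  \<open>s\<close> without constant term. Its nonnegativity for all \<open>s\<close> forces the
  linear coefficient, a multiple of the squared norm of \<open>Q *v v\<close>, to vanish.\<close>

lemma psd_kernel:
  fixes Q :: "real^'n^'n"
  assumes sym: "\<And>u v. v \<bullet> (Q *v u) = u \<bullet> (Q *v v)" and psd: "\<And>v. v \<bullet> (Q *v v) \<ge> 0"
    and v: "v \<bullet> (Q *v v) = 0"
  shows "Q *v v = 0"
proof -
  let ?w = "Q *v v"
  define a b where "a = ?w \<bullet> ?w" and "b = ?w \<bullet> (Q *v ?w)"
  have b: "b \<ge> 0"
    unfolding b_def by (rule psd)
  have pos: "- 2 * s * a + s\<^sup>2 * b \<ge> 0" for s
  proof -
    have "(v - s *\<^sub>R ?w) \<bullet> (Q *v (v - s *\<^sub>R ?w)) = - 2 * s * a + s\<^sup>2 * b"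
      using v sym[of v ?w]
      by (simp add: a_def b_def power2_eq_square algebra_simps)
    thus ?thesis
      using psd by metis
  qed
  \<comment> \<open>Adding \<open>1\<close> avoids a zero denominator; with this \<open>s\<close>
    the quadratic equals \<open>- s\<^sup>2 * (b + 2)\<close>.\<close>
  define s where "s = a / (b + 1)"
  have a: "a = s * (b + 1)"
    using b by (simp add: s_def)
  have "s\<^sup>2 * (b + 2) \<le> 0"
    using pos[of s] unfolding a by (simp add: power2_eq_square algebra_simps)
  hence "s = 0"
    using b by (simp add: mult_le_0_iff)
  hence "a = 0"
    by (simp add: a)
  thus ?thesis by (simp add: a_def)
qed

section \<open>Support functions and first-order optimality\<close>

text \<open>Compactness makes the supremum attained and finite, so later arguments can use a
  real-valued \<open>h\<close> in place of \<open>ereal\<close> arithmetic.\<close>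

lemma support_fun_compact:
  assumes "compact S" and "S \<noteq> {}"
  obtains h where "\<And>x. support_fun S x = ereal (h x)"
    and "\<And>x y. y \<in> S \<Longrightarrow> y \<bullet> x \<le> h x"
    and "\<And>x. \<exists>y\<in>S. y \<bullet> x = h x"
proof -
  have "\<exists>y\<in>S. \<forall>z\<in>S. z \<bullet> x \<le> y \<bullet> x" for x
    using assms by (intro continuous_attains_sup continuous_intros)
  then obtain s where s: "\<And>x. s x \<in> S" "\<And>x z. z \<in> S \<Longrightarrow> z \<bullet> x \<le> s x \<bullet> x"
    by metis
  have "support_fun S x = ereal (s x \<bullet> x)" for x
    unfolding support_fun_def using s by (intro antisym SUP_least SUP_upper2[of "s x"]) auto
  thus ?thesis
    using s that[of "\<lambda>x. s x \<bullet> x"] by blast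
qed

lemma support_fun_orthogonal_comp:
  assumes "x \<in> S"
  shows "support_fun (S\<^sup>\<bottom>) x = 0"
proof -
  have "y \<bullet> x = 0" if "y \<in> S\<^sup>\<bottom>" for y
    using that assms by (auto simp: orthogonal_comp_def orthogonal_def inner_commute)
  moreover have "S\<^sup>\<bottom> \<noteq> {}"
    using subspace_0[OF subspace_orthogonal_comp, of S] by auto
  ultimately show ?thesis
    unfolding support_fun_def by simp
qed

text \<open>Linearizing the loss at the minimizer leaves a positively homogeneous convex problem on
  \<open>E\<close>, whose minimum is therefore \<open>0\<close>. This puts the scaled negative gradient into
  \<open>A + I + E\<^sup>\<bottom>\<close>, and the minimum being attained forces the \<open>A\<close>-component into the exposed face,
  so no subdifferential calculus is needed.\<close>

lemma penalized_stationarity: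
  fixes f :: "real^'n \<Rightarrow> real"
  assumes GD: "GDERIV f x :> g"
    and A: "compact A" "convex A" "A \<noteq> {}"
    and I: "compact I" "convex I" "I \<noteq> {}"
    and E: "subspace E" and xM: "x \<in> model_subspace I E" and lam: "lam > 0"
    and min: "\<And>y. penalized_objective f lam A I E x \<le> penalized_objective f lam A I E y"
  obtains zA zI zE where "zA \<in> support_face A x" "zI \<in> I" "zE \<in> E\<^sup>\<bottom>"
    "g + lam *\<^sub>R (zA + zI + zE) = 0"
proof -
  obtain hA where hA: "\<And>y. support_fun A y = ereal (hA y)" "\<And>y z. z \<in> A \<Longrightarrow> z \<bullet> y \<le> hA y"
    "\<And>y. \<exists>z\<in>A. z \<bullet> y = hA y"
    using support_fun_compact[OF A(1,3)] by metis
  obtain hI where hI: "\<And>y. support_fun I y = ereal (hI y)" "\<And>y z. z \<in> I \<Longrightarrow> z \<bullet> y \<le> hI y"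
    "\<And>y. \<exists>z\<in>I. z \<bullet> y = hI y"
    using support_fun_compact[OF I(1,3)] by metis
  have xE: "x \<in> E" and xI: "\<And>z. z \<in> I \<Longrightarrow> z \<bullet> x = 0"
    using xM span_base
    by (auto simp: model_subspace_def orthogonal_comp_def orthogonal_def inner_commute)
  have obj: "penalized_objective f lam A I E y = ereal (f y + lam * (hA y + hI y))" if "y \<in> E" for y
    using that by (simp add: penalized_objective_def support_fun_orthogonal_comp hA(1) hI(1))
  define k where "k y = lam * (hA y + hI y)" for y
  have kmin: "f x + k x \<le> f y + k y" if "y \<in> E" for y
    using min[of y] obj[OF that] obj[OF xE] by (simp add: k_def)
  have kconv: "k ((1 - t) *\<^sub>R y + t *\<^sub>R w) \<le> (1 - t) * k y + t * k w" if "0 \<le> t" "t \<le> 1" for t y w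
  proof -
    \<comment> \<open>Maximizers at the convex combination serve as competitors at both
      endpoints.\<close>
    obtain a b where ab: "a \<in> A" "a \<bullet> ((1 - t) *\<^sub>R y + t *\<^sub>R w) = hA ((1 - t) *\<^sub>R y + t *\<^sub>R w)"
      "b \<in> I" "b \<bullet> ((1 - t) *\<^sub>R y + t *\<^sub>R w) = hI ((1 - t) *\<^sub>R y + t *\<^sub>R w)"
      using hA(3) hI(3) by metis
    have "(1 - t) * (a \<bullet> y) \<le> (1 - t) * hA y" "t * (a \<bullet> w) \<le> t * hA w"
      "(1 - t) * (b \<bullet> y) \<le> (1 - t) * hI y" "t * (b \<bullet> w) \<le> t * hI w"
      using that ab(1,3) hA(2) hI(2) by (auto intro: mult_left_mono)
    hence "hA ((1 - t) *\<^sub>R y + t *\<^sub>R w) + hI ((1 - t) *\<^sub>R y + t *\<^sub>R w)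
        \<le> (1 - t) * (hA y + hI y) + t * (hA w + hI w)"
      unfolding ab(2,4)[symmetric] by (simp add: inner_add_right distrib_left)
    from mult_left_mono[OF this, of lam] show ?thesis
      using lam by (simp add: k_def algebra_simps)
  qed
  define \<phi> where "\<phi> y = g \<bullet> y + k y" for y
  have \<phi>min: "\<phi> x \<le> \<phi> y" if y: "y \<in> E" for y
  proof -
    have "((\<lambda>s. f (x + s *\<^sub>R (y - x))) has_real_derivative (y - x) \<bullet> g) (at 0)"
      using GD by (intro GDERIV_along_line) simp
    \<comment> \<open>Minimality bounds the increase of \<open>f\<close> on the segment below by the
      decrease of \<open>k\<close>, which by convexity of \<open>k\<close> is at least
      \<open>t * (k x - k y)\<close>.\<close>
    hence "(y - x) \<bullet> g \<ge> k x - k y"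
    proof (rule DERIV_ge_right)
      fix t :: real assume t: "0 < t" "t < 1"
      have eq: "x + t *\<^sub>R (y - x) = (1 - t) *\<^sub>R x + t *\<^sub>R y"
        by (simp add: algebra_simps)
      have "(1 - t) *\<^sub>R x + t *\<^sub>R y \<in> E"
        using E xE y by (simp add: subspace_add subspace_scale)
      from kmin[OF this] kconv[of t x y] t
      show "f (x + t *\<^sub>R (y - x)) - f (x + 0 *\<^sub>R (y - x)) \<ge> t * (k x - k y)"
        unfolding eq by (simp add: algebra_simps)
    qed
    thus ?thesis
      by (simp add: \<phi>_def inner_diff_left inner_diff_right inner_commute)
  qed
  have h0: "hA 0 = 0" "hI 0 = 0"
    using hA(3)[of 0] hI(3)[of 0] by auto
  have k2: "k (2 *\<^sub>R x) \<le> 2 * k x"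
  proof -
    obtain a b where ab: "a \<in> A" "a \<bullet> 2 *\<^sub>R x = hA (2 *\<^sub>R x)"
      "b \<in> I" "b \<bullet> 2 *\<^sub>R x = hI (2 *\<^sub>R x)"
      using hA(3) hI(3) by metis
    have "hA (2 *\<^sub>R x) + hI (2 *\<^sub>R x) \<le> 2 * (hA x + hI x)"
      using hA(2)[OF ab(1), of x] hI(2)[OF ab(3), of x] unfolding ab(2,4)[symmetric] by simp
    thus ?thesis
      using lam by (simp add: k_def)
  qed
  \<comment> \<open>The competitors \<open>0\<close> and \<open>2 *\<^sub>R x\<close> both lie in
    \<open>E\<close>: the first gives \<open>\<phi> x \<le> 0\<close>, the second
    \<open>\<phi> x \<le> 2 * \<phi> x\<close>.\<close>
  have "\<phi> x \<le> 0"
    using \<phi>min[of 0] E h0 by (simp add: \<phi>_def k_def subspace_0)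
  moreover have "\<phi> x \<ge> 0"
    using \<phi>min[of "2 *\<^sub>R x"] E xE k2 by (simp add: \<phi>_def subspace_scale)
  ultimately have \<phi>x: "\<phi> x = 0" by simp
  let ?S = "(A + I) + E\<^sup>\<bottom>"
  have "- (1 / lam) *\<^sub>R g \<in> ?S"
  proof (rule ccontr)
    assume notin: "- (1 / lam) *\<^sub>R g \<notin> ?S"
    \<comment> \<open>Strict separation needs \<open>?S\<close> closed: it is the sum of a compact
      set and a closed one.\<close>
    have "closed (E\<^sup>\<bottom>)"
      by (simp add: closed_subspace subspace_orthogonal_comp)
    moreover have "compact (A + I)"
      using compact_sums[OF A(1) I(1)]
      by (auto simp: set_plus_def elim!: back_subst[of compact])
    ultimately have "closed (\<Union>a\<in>A + I. \<Union>e\<in>E\<^sup>\<bottom>. {a + e})"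
      by (intro compact_closed_sums)
    moreover have "(\<Union>a\<in>A + I. \<Union>e\<in>E\<^sup>\<bottom>. {a + e}) = ?S"
      by (auto simp: set_plus_def)
    ultimately have "closed ?S" by simp
    moreover have "convex ?S"
      using A I
      by (intro convex_set_plus subspace_imp_convex[OF subspace_orthogonal_comp])
    ultimately obtain d b where d: "d \<bullet> (- (1 / lam) *\<^sub>R g) < b" "\<And>z. z \<in> ?S \<Longrightarrow> d \<bullet> z > b"
      using separating_hyperplane_closed_point notin by metis
    \<comment> \<open>Maximizing against \<open>- d\<close> minimizes \<open>d\<close> over
      \<open>A\<close> and over \<open>I\<close>.\<close>
    obtain a c where ac: "a \<in> A" "a \<bullet> (- d) = hA (- d)" "c \<in> I" "c \<bullet> (- d) = hI (- d)"
      using hA(3) hI(3) by metis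
    have dac: "d \<bullet> (a + c + e) > b" if "e \<in> E\<^sup>\<bottom>" for e
      using that ac by (intro d(2)) auto
    have "d \<bullet> e = 0" if e: "e \<in> E\<^sup>\<bottom>" for e
    proof (rule ccontr)
      assume ne: "d \<bullet> e \<noteq> 0"
      \<comment> \<open>A functional bounded below on a subspace vanishes there: this multiple of
        \<open>e\<close> brings the value exactly to \<open>b\<close>, against the strict
        bound.\<close>
      define s where "s = (b - d \<bullet> (a + c)) / (d \<bullet> e)"
      have "s *\<^sub>R e \<in> E\<^sup>\<bottom>"
        using e by (simp add: subspace_scale subspace_orthogonal_comp)
      from dac[OF this] show False
        using ne by (simp add: s_def inner_add_right)
    qed
    hence "d \<in> (E\<^sup>\<bottom>)\<^sup>\<bottom>"
      by (auto simp: orthogonal_comp_def[of "E\<^sup>\<bottom>"] orthogonal_def inner_commute)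
    hence "- d \<in> E"
      using E by (simp add: orthogonal_comp_self subspace_neg)
    hence ge: "\<phi> (- d) \<ge> 0"
      using \<phi>min \<phi>x by metis
    have "b < d \<bullet> (a + c)"
      using dac[of 0] by (simp add: subspace_0 subspace_orthogonal_comp)
    hence "hA (- d) + hI (- d) < - b"
      using ac by (simp add: inner_add_right inner_commute)
    hence "k (- d) < lam * - b"
      unfolding k_def using lam by (intro mult_strict_left_mono)
    \<comment> \<open>The two strict bounds add up to \<open>\<phi> (- d) < 0\<close>, although
      \<open>- d\<close> lies in \<open>E\<close>.\<close>
    moreover have "- (g \<bullet> d) < lam * b"
      using d(1) lam by (simp add: inner_commute field_simps)
    ultimately show False
      using ge by (simp add: \<phi>_def)
  qed
  then obtain zA zI zE where z: "zA \<in> A" "zI \<in> I" "zE \<in> E\<^sup>\<bottom>"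
    and eq: "- (1 / lam) *\<^sub>R g = zA + zI + zE"
    by (blast elim!: set_plus_elim)
  have kkt: "g + lam *\<^sub>R (zA + zI + zE) = 0"
    unfolding eq[symmetric] using lam by simp
  \<comment> \<open>Pairing the stationarity equation with \<open>x\<close> removes
    \<open>zI\<close> and \<open>zE\<close>; comparison with \<open>\<phi> x = 0\<close> then shows
    that \<open>zA\<close> attains \<open>hA x\<close>.\<close>
  have "zE \<bullet> x = 0"
    using z(3) xE by (auto simp: orthogonal_comp_def orthogonal_def inner_commute)
  hence "(g + lam *\<^sub>R (zA + zI + zE)) \<bullet> x = g \<bullet> x + lam * (zA \<bullet> x)"
    using xI[OF z(2)] by (simp add: inner_add_left)
  hence "g \<bullet> x + lam * (zA \<bullet> x) = 0"
    by (simp add: kkt)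
  moreover have "hI x = 0"
    using hI(3)[of x] xI by auto
  hence "g \<bullet> x + lam * hA x = 0"
    using \<phi>x by (simp add: \<phi>_def k_def)
  ultimately have "lam * (zA \<bullet> x) = lam * hA x"
    by linarith
  hence "zA \<in> support_face A x"
    using z(1) lam by (simp add: support_face_def hA(1))
  thus ?thesis
    using that z kkt by blast
qed

section \<open>Projectors and the pseudoinverse of a compression\<close>

lemma orth_projector_fixes:
  assumes "subspace S" and "x \<in> S"
  shows "orth_projector S *v x = x"
  by (rule orth_decomp_unique[OF assms(1), of _ _ x])
    (use assms orth_projector_works[OF assms(1)] in \<open>auto simp: subspace_0 subspace_orthogonal_comp\<close>)

lemma orth_projector_kills:
  assumes "subspace S" and "x \<in> S\<^sup>\<bottom>"
  shows "orth_projector S *v x = 0"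
  by (rule orth_decomp_unique[OF assms(1), of _ _ x])
    (use assms orth_projector_works[OF assms(1)] in \<open>auto simp: subspace_0\<close>)

text \<open>The compression takes values in \<open>S\<close>, so \<open>P\<close> is absorbed on the
  left of the symmetric matrix \<open>?B ** ?X\<close>, and by transposition on its right. The
  identity \<open>?X = ?X ** ?B ** ?X\<close> transfers this to \<open>?X\<close>.\<close>

lemma pinv_cong_orth_projector:
  fixes S :: "(real^'n) set" and Q :: "real^'n^'n"
  assumes S: "subspace S"
  defines "P \<equiv> orth_projector S"
  shows "pinv (P ** Q ** P) ** P = pinv (P ** Q ** P)"
proof -
  let ?B = "P ** Q ** P" and ?X = "pinv (P ** Q ** P)"
  note X = is_pinv_pinv[of ?B, unfolded is_pinv_def]
  have PP: "P ** P = P"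
    using orth_projector_works(1)[OF S] orth_projector_fixes[OF S]
    by (simp add: P_def matrix_eq flip: matrix_vector_mul_assoc)
  have BXP: "?B ** ?X ** P = ?B ** ?X"
  proof -
    have "P ** (?B ** ?X) = ?B ** ?X"
      by (simp add: matrix_mul_assoc PP)
    hence "transpose (?B ** ?X) ** transpose P = transpose (?B ** ?X)"
      by (metis matrix_transpose_mul)
    thus ?thesis
      using X by (simp add: P_def transpose_orth_projector[OF S])
  qed
  have XBX: "?X ** (?B ** ?X) = ?X"
    using X by (simp add: matrix_mul_assoc)
  hence "?X ** P = ?X ** (?B ** ?X ** P)"
    by (simp only: matrix_mul_assoc)
  thus ?thesis
    by (simp only: BXP XBX)
qed

text \<open>The residual \<open>?w\<close> lies in the kernel of \<open>B\<close>, so the form of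
  \<open>Q\<close> vanishes at \<open>P *v ?w\<close>, and \<open>psd_kernel\<close> gives
  \<open>Q *v (P *v ?w) = 0\<close>. This takes the place of invertibility of \<open>B\<close> on
  \<open>S\<close>.\<close>

lemma psd_compression_pinv:
  fixes S :: "(real^'n) set" and Q :: "real^'n^'n"
  assumes S: "subspace S" and v: "v \<in> S"
    and sym: "\<And>u v. v \<bullet> (Q *v u) = u \<bullet> (Q *v v)" and psd: "\<And>v. v \<bullet> (Q *v v) \<ge> 0"
  defines "P \<equiv> orth_projector S"
  defines "B \<equiv> P ** Q ** P"
  shows "(Q ** P ** pinv B) *v (P *v (Q *v v)) = Q *v v"
proof -
  have Pv: "P *v v = v"
    using orth_projector_fixes[OF S v] by (simp add: P_def)
  have Psym: "a \<bullet> (P *v b) = (P *v a) \<bullet> b" for a b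
    by (metis P_def S transpose_orth_projector dot_lmul_matrix transpose_matrix_vector)
  let ?w = "v - pinv B *v (B *v v)"
  have "B ** pinv B ** B = B"
    using is_pinv_pinv[of B] by (simp add: is_pinv_def)
  hence "B *v ?w = 0"
    by (simp add: matrix_vector_mult_diff_distrib matrix_vector_mul_assoc matrix_mul_assoc)
  hence "?w \<bullet> (P *v (Q *v (P *v ?w))) = 0"
    by (simp add: B_def flip: matrix_vector_mul_assoc)
  hence "(P *v ?w) \<bullet> (Q *v (P *v ?w)) = 0"
    by (simp add: Psym)
  hence "Q *v (P *v ?w) = 0"
    by (rule psd_kernel[OF sym psd])
  hence "Q *v (P *v (pinv B *v (B *v v))) = Q *v v"
    by (simp add: matrix_vector_mult_diff_distrib Pv)
  moreover have "B *v v = P *v (Q *v v)"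
    by (simp add: B_def Pv flip: matrix_vector_mul_assoc)
  ultimately show ?thesis
    by (simp flip: matrix_vector_mul_assoc)
qed

section \<open>From stationarity to the projected inclusion\<close>

theorem theorem3p8:
  fixes l :: "real^'p \<Rightarrow> real"
    and A I E C M :: "(real^'p) set"
    and \<theta>star \<theta>hat W R :: "real^'p"
    and lam r :: real
    and Q PM PMperp :: "real^'p^'p"
  assumes "convex_on UNIV l" and "twice_continuously_differentiable l"
    and "bounded A" and "closed A" and "convex A" and "A \<noteq> {}"
    and "bounded I" and "closed I" and "convex I" and "0 \<in> rel_interior I"
    and "subspace E"
    and "M = model_subspace I E"
    and "\<theta>star \<in> M" and "lam > 0" and "r > 0"
    and "convex C" and "\<theta>star \<in> C"
    and "Q = hessian l \<theta>star"
    and "PM = orth_projector M" and "PMperp = orth_projector (M\<^sup>\<bottom>)"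
    and "restricted_strongly_convex l \<theta>star C M"
    and "irrepresentable Q A I E"
    and "\<And>\<theta>. is_arg_min (penalized_objective l lam A I E) (\<lambda>_. True) \<theta> \<longleftrightarrow> \<theta> = \<theta>hat"
    and "\<theta>hat \<in> cball \<theta>star r \<inter> M"
    and "W = gradient l \<theta>star"
    and "R = gradient l \<theta>hat - W - Q *v (\<theta>hat - \<theta>star)"
  shows "\<exists>zA \<in> (\<Union>\<theta>\<in>cball \<theta>star r \<inter> M. support_face A \<theta>).
    (PMperp ** Q ** PM ** pinv (PM ** Q ** PM)) *v (W + lam *\<^sub>R zA + R)
      \<in> (*v) PMperp ` ((W + R) +o (*\<^sub>R) lam ` (zA +o (I + E\<^sup>\<bottom>)))"
proof -
  have G: "GDERIV l y :> gradient l y" for y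
    using assms(2) by (simp add: GDERIV_gradient twice_continuously_differentiable_def)
  have H: "(gradient l has_derivative (\<lambda>h. Q *v h)) (at \<theta>star)"
    using assms(2) unfolding assms(18)
    by (intro has_derivative_hessian) (simp add: twice_continuously_differentiable_def)
  note sym = second_derivative_symmetric[OF G H]
  note psd = convex_second_derivative_nonneg[OF assms(1) G H]
  have M: "subspace M"
    unfolding assms(12) model_subspace_def
    using assms(11) by (intro subspace_inter subspace_orthogonal_comp)
  have "I \<noteq> {}"
    using assms(10) rel_interior_subset by blast
  have min: "penalized_objective l lam A I E \<theta>hat \<le> penalized_objective l lam A I E y" for y
    using assms(23)[of \<theta>hat] by (auto simp: is_arg_min_def not_less)
  have A: "compact A" and I: "compact I"
    using assms(3,4,7,8) by (auto simp: compact_eq_bounded_closed)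
  have mem: "\<theta>hat \<in> model_subspace I E"
    using assms(12,24) by simp
  obtain zA zI zE where z: "zA \<in> support_face A \<theta>hat" "zI \<in> I" "zE \<in> E\<^sup>\<bottom>"
    and kkt: "gradient l \<theta>hat + lam *\<^sub>R (zA + zI + zE) = 0"
    using penalized_stationarity[OF G A assms(5,6) I assms(9) \<open>I \<noteq> {}\<close> assms(11) mem assms(14) min]
    by blast
  define \<Delta> where "\<Delta> = \<theta>hat - \<theta>star"
  have \<Delta>: "\<Delta> \<in> M"
    unfolding \<Delta>_def using M assms(13,24) by (auto intro: subspace_diff)
  \<comment> \<open>By the choice of \<open>R\<close>, the gradient at \<open>\<theta>hat\<close> is
    \<open>W + R + Q *v \<Delta>\<close>.\<close>
  have eq: "W + R + lam *\<^sub>R (zA + (zI + zE)) = - (Q *v \<Delta>)"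
    using kkt unfolding assms(26) \<Delta>_def by (simp add: algebra_simps eq_neg_iff_add_eq_0)
  have "zI + zE \<in> M\<^sup>\<bottom>"
  proof (rule subspace_add[OF subspace_orthogonal_comp])
    show "zI \<in> M\<^sup>\<bottom>" "zE \<in> M\<^sup>\<bottom>"
      using z(2,3) span_base unfolding assms(12) model_subspace_def
      by (auto simp: orthogonal_comp_def orthogonal_commute)
  qed
  hence "PM *v (zI + zE) = 0"
    unfolding assms(19) by (rule orth_projector_kills[OF M])
  moreover have "W + lam *\<^sub>R zA + R = - (Q *v \<Delta>) - lam *\<^sub>R (zI + zE)"
    unfolding eq[symmetric] by (simp add: algebra_simps)
  ultimately have PMw: "PM *v (W + lam *\<^sub>R zA + R) = - (PM *v (Q *v \<Delta>))"
    by (simp only: matrix_vector_mult_diff_distrib matrix_vector_mult_scaleR scaleR_zero_right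
        diff_zero linear_neg[OF matrix_vector_mul_linear])
  \<comment> \<open>\<open>?T\<close> absorbs \<open>PM\<close> on the right, so it sees only the
    projection onto \<open>M\<close> computed in \<open>PMw\<close>.\<close>
  let ?T = "Q ** PM ** pinv (PM ** Q ** PM)"
  have "?T ** PM = Q ** PM ** (pinv (PM ** Q ** PM) ** PM)"
    by (simp only: matrix_mul_assoc)
  also have "\<dots> = ?T"
    unfolding assms(19) pinv_cong_orth_projector[OF M] ..
  finally have TPM: "?T ** PM = ?T" .
  have "?T *v (W + lam *\<^sub>R zA + R) = ?T *v (PM *v (W + lam *\<^sub>R zA + R))"
    by (simp only: matrix_vector_mul_assoc TPM)
  also have "\<dots> = - (Q *v \<Delta>)"
    unfolding PMw unfolding assms(19)
    by (simp only: linear_neg[OF matrix_vector_mul_linear] psd_compression_pinv[OF M \<Delta> sym psd])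
  also have "\<dots> = W + R + lam *\<^sub>R (zA + (zI + zE))"
    by (simp only: eq)
  \<comment> \<open>The identity already holds before projection; applying \<open>PMperp\<close>
    gives the required form, with \<open>zI + zE\<close> as the element of
    \<open>I + E\<^sup>\<bottom>\<close>.\<close>
  finally have "PMperp *v (?T *v (W + lam *\<^sub>R zA + R)) = PMperp *v (W + R + lam *\<^sub>R (zA + (zI + zE)))"
    by (rule arg_cong)
  hence lhs: "(PMperp ** Q ** PM ** pinv (PM ** Q ** PM)) *v (W + lam *\<^sub>R zA + R)
      = PMperp *v (W + R + lam *\<^sub>R (zA + (zI + zE)))"
    by (simp only: matrix_vector_mul_assoc matrix_mul_assoc)
  show ?thesis
  proof (rule bexI[of _ zA])
    have "W + R + lam *\<^sub>R (zA + (zI + zE)) \<in> (W + R) +o (*\<^sub>R) lam ` (zA +o (I + E\<^sup>\<bottom>))"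
      using z by (intro set_plus_intro2 imageI set_plus_intro)
    thus "(PMperp ** Q ** PM ** pinv (PM ** Q ** PM)) *v (W + lam *\<^sub>R zA + R)
        \<in> (*v) PMperp ` ((W + R) +o (*\<^sub>R) lam ` (zA +o (I + E\<^sup>\<bottom>)))"
      unfolding lhs by (rule imageI)
    show "zA \<in> (\<Union>\<theta>\<in>cball \<theta>star r \<inter> M. support_face A \<theta>)"
      using z(1) assms(24) by (rule UN_I[rotated])
  qed
qed

end
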